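(* For each positive integer $n$, let $L(n)$ denote the number of $O$-sequences of length $n$, i.e. the number of finite sequences $h=(h_0,h_1,\dots,h_e)$ (with $e\ge 0$ arbitrary and $h_e\neq 0$) that are $O$-sequences and satisfy $\sum_{i=0}^e h_i=n$. Then there exist real constants $c_1,c_2>0$ such that for all integers $n>2$, $$e^{c_1\sqrt{n}}\le L(n)\le e^{c_2\sqrt{n}\log n}.$$
   Context: Let $k$ be a field. A standard graded artinian $k$-algebra is a commutative graded $k$-algebra $A=\bigoplus_{i=0}^e A_i$ with $A_0=k$, generated as a $k$-algebra by finitely many elements of degree 1 (equivalently, $A\cong k[x_1,\dots,x_r]/I$ with $I$ a homogeneous ideal, all $x_i$ of degree 1), and with $\dim_k A<\infty$; here $e$ is the largest degree with $A_e\ne 0$. Its Hilbert function is the sequence $h=(h_0,h_1,\dots,h_e)$ with $h_i=\dim_k A_i$ (so $h_0=1$ and $h_e\ne 0$). A finite sequence $h=(h_0,h_1,\dots,h_e)$ of integers with $h_e\neq 0$ is called an $O$-sequence if it is the Hilbert function of some standard graded artinian $k$-algebra. Equivalently, in purely combinatorial terms, $h$ is an $O$-sequence if it is the $f$-vector of a finite multicomplex: there is a finite nonempty set $M$ of monomials in finitely many variables that is closed under divisibility (if $m\in M$ and $m'$ divides $m$, then $m'\in M$) such that $h_i$ is the number of monomials of degree $i$ in $M$ for every $0\le i\le e$, and $e$ is the largest degree of a monomial in $M$. (The two definitions are equivalent, and the notion does not depend on the field $k$.) The length of an $O$-sequence $h=(h_0,\dots,h_e)$ is the sum $\sum_{i=0}^e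 h_i$ (not the number of entries). $\log$ denotes the natural logarithm. *)

theory Defs
  imports Complex_Main "HOL-Library.Multiset"
begin

text \<open>
  A monomial in variables \<open>x\<^sub>0, x\<^sub>1, \<dots>\<close> is represented by the multiset of its variable indices:
  divisibility is \<open>\<subseteq>#\<close>, the degree is \<open>size\<close>, and the monomial \<open>1\<close> is \<open>{#}\<close>. A finite set of
  such monomials involves only finitely many variables.
\<close>

definition multicomplex :: "nat multiset set \<Rightarrow> bool" where
  "multicomplex M \<longleftrightarrow>
     finite M \<and> M \<noteq> {} \<and> (\<forall>m\<in>M. \<forall>m'. m' \<subseteq># m \<longrightarrow> m' \<in> M)"

definition f_vector :: "nat multiset set \<Rightarrow> nat list" where
  "f_vector M = map (\<lambda>i. card {m \<in> M. size m = i}) [0..<Suc (Max (size ` M))]"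

text \<open>
  A sequence \<open>(h\<^sub>0, \<dots>, h\<^sub>e)\<close> is the list \<open>[h\<^sub>0, \<dots>, h\<^sub>e]\<close>. Its last entry is nonzero, because \<open>e\<close>
  is the largest degree that occurs in the multicomplex.
\<close>

definition O_sequence :: "nat list \<Rightarrow> bool" where
  "O_sequence h \<longleftrightarrow> (\<exists>M. multicomplex M \<and> h = f_vector M)"

text \<open>
  The length of an O-sequence is the sum of its entries, not the number of them. The set counted
  here is finite: all entries of an O-sequence are positive, so it consists of compositions of
  \<open>n\<close>.
\<close>

definition L :: "nat \<Rightarrow> nat" where
  "L n = card {h. O_sequence h \<and> sum_list h = n}"

end

theory Submission
  imports Defs
begin

text \<open>
  Upper bound: a set of at most \<open>d\<close> monomials of degree \<open>d\<close> has a shadow at least as large as itself.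
  Hence \<open>h\<^sub>i \<le> i\<close> implies \<open>h\<^sub>i\<^sub>+\<^sub>1 \<le> h\<^sub>i\<close>. If \<open>h\<^sub>j > j\<close> for all \<open>j \<le> K\<close>, then the length exceeds
  \<open>(K + 1)\<^sup>2 / 2\<close>; so with \<open>K\<close> about \<open>\<surd>(2n)\<close> the sequence is nonincreasing from position \<open>K\<close> on, with
  entries at most \<open>K\<close>. It is determined by its first \<open>K\<close> entries and the \<open>K\<close> parts of the conjugate
  of the remaining partition, that is, by \<open>2K\<close> numbers in \<open>{0, \<dots>, n}\<close>.

  Lower bound: multicomplexes in two variables realise every sequence that consists of
  \<open>1, 2, \<dots>, d\<close> followed by a nonincreasing sequence with values in \<open>{1, \<dots>, d}\<close>. Choosing
  the latter to be a subset of \<open>{2, \<dots>, d}\<close> in descending order, padded with ones, gives \<open>2\<^bsup>d-1\<^esup>\<close>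
  O-sequences of length \<open>n\<close> as soon as \<open>d (d + 1) \<le> n\<close>.
\<close>

section \<open>Shadows of small sets of monomials\<close>

text \<open>
  Induction on the variables: split \<open>S\<close> into layers \<open>T a\<close> by the exponent \<open>a\<close> of \<open>x\<close>, and let \<open>b\<close>
  be the first exponent with an empty layer. Each layer below \<open>b\<close> leaves room for the \<open>b - 1\<close> other
  nonempty ones, so the induction hypothesis applies to it and stays inside the layer. Above \<open>b\<close>
  remove \<open>x\<close>, which never reaches a layer below \<open>b\<close>.
\<close>

lemma removal_injection:
  fixes S :: "'a multiset set"
  assumes "finite V" "finite S" "card S \<le> d"
    and "\<And>m. m \<in> S \<Longrightarrow> size (filter_mset (\<lambda>v. v \<in> V) m) = d"
    and "\<And>m m'. m \<in> S \<Longrightarrow> m' \<in> S \<Longrightarrow>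
           filter_mset (\<lambda>v. v \<notin> V) m = filter_mset (\<lambda>v. v \<notin> V) m'"
  shows "\<exists>f. inj_on f S \<and> (\<forall>m\<in>S. \<exists>v\<in>V. v \<in># m \<and> f m = m - {#v#})"
  using assms
proof (induction V arbitrary: S d rule: finite_induct)
  case empty
  \<comment> \<open>With no variables the degree \<open>d\<close> is 0 as soon as \<open>S\<close>
    has an element, and then \<open>card S \<le> d\<close> is violated.\<close>
  have "S = {}" using empty.prems by (cases "S = {}") auto
  then show ?case by auto
next
  case (insert x V)
  define T where "T a = {m \<in> S. count m x = a}" for a
  have T_sub: "T a \<subseteq> S" for a by (auto simp: T_def)
  have fT: "finite (T a)" for a using T_sub insert.prems(1) finite_subset by blast
  have ex: "\<exists>a. T a = {}"
  proof -
    obtain a where "a \<notin> (\<lambda>m. count m x) ` S"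
      using insert.prems(1) by (metis ex_new_if_finite finite_imageI infinite_UNIV_nat)
    then have "T a = {}" by (auto simp: T_def)
    then show ?thesis ..
  qed
  define b where "b = (LEAST a. T a = {})"
  have b0: "T b = {}" unfolding b_def by (rule LeastI_ex[OF ex])
  have bl: "T a \<noteq> {}" if "a < b" for a using that not_less_Least unfolding b_def by blast
  have card_T: "card (T a) \<le> d - a" if "a < b" for a
  proof -
    have "card (\<Union>c\<in>{..<b}. T c) = (\<Sum>c<b. card (T c))"
      by (rule card_UN_disjoint) (auto simp: fT T_def insert.prems(1))
    moreover have "card (\<Union>c\<in>{..<b}. T c) \<le> d"
      by (rule order_trans[OF card_mono insert.prems(2)])
         (use insert.prems(1) T_sub in auto)
    moreover have "(\<Sum>c<b. card (T c)) = card (T a) + (\<Sum>c\<in>{..<b} - {a}. card (T c))"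
      using that by (subst sum.remove[of _ a]) auto
    moreover have "(\<Sum>c\<in>{..<b} - {a}. card (T c)) \<ge> (\<Sum>c\<in>{..<b} - {a}. 1)"
      by (rule sum_mono) (use bl fT in \<open>auto simp: Suc_le_eq card_gt_0_iff\<close>)
    moreover have "(\<Sum>c\<in>{..<b} - {a}. 1::nat) = b - 1" using that by simp
    ultimately show ?thesis using that by linarith
  qed
  have "\<exists>f. inj_on f (T a) \<and> (\<forall>m\<in>T a. \<exists>v\<in>V. v \<in># m \<and> f m = m - {#v#})"
    if "a < b" for a
  proof (rule insert.IH[OF fT card_T[OF that]])
    fix m assume m: "m \<in> T a"
    have "filter_mset (\<lambda>v. v \<in> insert x V) m
        = filter_mset (\<lambda>v. v \<in> V) m + replicate_mset (count m x) x"
      using insert.hyps(2) by (intro multiset_eqI) auto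
    then have "d = size (filter_mset (\<lambda>v. v \<in> V) m) + count m x"
      using insert.prems(3)[of m] m T_sub by auto
    then show "size (filter_mset (\<lambda>v. v \<in> V) m) = d - a" using m by (simp add: T_def)
  next
    fix m m' assume m: "m \<in> T a" "m' \<in> T a"
    have "filter_mset (\<lambda>v. v \<notin> insert x V) m = filter_mset (\<lambda>v. v \<notin> insert x V) m'"
      using m T_sub insert.prems(4) by blast
    then have *: "(if v \<notin> insert x V then count m v else 0) = (if v \<notin> insert x V then count m' v else 0)" for v
      by (metis count_filter_mset)
    show "filter_mset (\<lambda>v. v \<notin> V) m = filter_mset (\<lambda>v. v \<notin> V) m'"
    proof (rule multiset_eqI)
      fix v
      show "count (filter_mset (\<lambda>v. v \<notin> V) m) v = count (filter_mset (\<lambda>v. v \<notin> V) m') v"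
        using *[of v] m by (cases "v = x") (auto simp: T_def)
    qed
  qed
  then obtain g where g_inj: "\<And>a. a < b \<Longrightarrow> inj_on (g a) (T a)"
    and g: "\<And>a m. a < b \<Longrightarrow> m \<in> T a \<Longrightarrow> \<exists>v\<in>V. v \<in># m \<and> g a m = m - {#v#}"
    by metis
  define f where "f m = (if count m x < b then g (count m x) m else m - {#x#})" for m
  have f_low: "count (f m) x = count m x" if m: "m \<in> S" "count m x < b" for m
  proof -
    have "m \<in> T (count m x)" using m(1) by (simp add: T_def)
    from g[OF m(2) this] obtain v where "v \<in> V" "f m = m - {#v#}"
      using m(2) by (auto simp: f_def)
    then show ?thesis using insert.hyps(2) by auto
  qed
  have high: "count m x > b" if "m \<in> S" "\<not> count m x < b" for m
    using that b0 by (cases "count m x = b") (auto simp: T_def)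
  have f_high: "count (f m) x \<ge> b" if "m \<in> S" "\<not> count m x < b" for m
    using high[OF that] that(2) by (simp add: f_def)
  have "inj_on f S"
  proof (rule inj_onI)
    fix m m' assume m: "m \<in> S" "m' \<in> S" and eq: "f m = f m'"
    consider "count m x < b" "count m' x < b" | "\<not> count m x < b" "\<not> count m' x < b"
      using f_low f_high m eq by (metis not_less)
    then show "m = m'"
    proof cases
      case 1
      then have "count m x = count m' x" using f_low m eq by metis
      with 1 eq m g_inj[of "count m x"] show ?thesis
        by (auto simp: f_def T_def inj_on_def)
    next
      case 2
      then have "x \<in># m" "x \<in># m'" using high m by (metis count_inI not_less_zero)+
      with 2 eq show ?thesis by (simp add: f_def) (metis insert_DiffM)
    qed
  qed
  moreover have "\<exists>v\<in>insert x V. v \<in># m \<and> f m = m - {#v#}" if m: "m \<in> S" for m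
  proof (cases "count m x < b")
    case True
    have "m \<in> T (count m x)" using m by (simp add: T_def)
    from g[OF True this] show ?thesis using True by (auto simp: f_def)
  next
    case False
    with high[OF m] have "x \<in># m" by (metis count_inI not_less_zero)
    with False show ?thesis by (auto simp: f_def)
  qed
  ultimately show ?case by blast
qed

text \<open>By \<open>removal_injection\<close>, any set of at most \<open>Suc i\<close> monomials
  of degree \<open>Suc i\<close> injects into degree \<open>i\<close>. If degree
  \<open>Suc i\<close> had more monomials than that, exactly \<open>Suc i\<close> of them would
  inject into at most \<open>i\<close>.\<close>

lemma multicomplex_card_antimono:
  assumes M: "multicomplex M" and le: "card {m \<in> M. size m = i} \<le> i"
  shows "card {m \<in> M. size m = Suc i} \<le> card {m \<in> M. size m = i}"
proof -
  have fin: "finite M" and closed: "\<And>m m'. m \<in> M \<Longrightarrow> m' \<subseteq># m \<Longrightarrow> m' \<in> M"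
    using M by (auto simp: multicomplex_def)
  have shadow: "card S \<le> card {m \<in> M. size m = i}"
    if S: "S \<subseteq> {m \<in> M. size m = Suc i}" "card S \<le> Suc i" for S
  proof -
    define V where "V = (\<Union>m\<in>S. set_mset m)"
    have fS: "finite S" using S fin by (simp add: finite_subset)
    have V: "filter_mset (\<lambda>v. v \<in> V) m = m" "filter_mset (\<lambda>v. v \<notin> V) m = {#}" if "m \<in> S" for m
      using that by (auto simp: V_def filter_mset_eq_conv)
    obtain f where f: "inj_on f S" "\<And>m. m \<in> S \<Longrightarrow> \<exists>v\<in>V. v \<in># m \<and> f m = m - {#v#}"
    proof -
      have "finite V" using fS by (auto simp: V_def)
      moreover have "size (filter_mset (\<lambda>v. v \<in> V) m) = Suc i" if "m \<in> S" for m
        using that S(1) V(1) by auto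
      moreover have "filter_mset (\<lambda>v. v \<notin> V) m = filter_mset (\<lambda>v. v \<notin> V) m'"
        if "m \<in> S" "m' \<in> S" for m m'
        by (simp only: V(2)[OF that(1)] V(2)[OF that(2)])
      ultimately show ?thesis using removal_injection[of V S "Suc i"] fS S(2) that by metis
    qed
    have "f ` S \<subseteq> {m \<in> M. size m = i}"
    proof
      fix y assume "y \<in> f ` S"
      then obtain m v where "m \<in> S" "v \<in># m" "y = m - {#v#}" using f(2) by blast
      then show "y \<in> {m \<in> M. size m = i}"
        using S(1) closed[of m y] by (auto simp: size_Diff_singleton)
    qed
    then show ?thesis using f(1) fin by (auto intro: card_inj_on_le)
  qed
  show ?thesis
  proof (cases "card {m \<in> M. size m = Suc i} \<le> Suc i")
    case True
    then show ?thesis using shadow by blast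
  next
    case False
    then have "Suc i \<le> card {m \<in> M. size m = Suc i}" by simp
    then obtain S where "S \<subseteq> {m \<in> M. size m = Suc i}" "card S = Suc i"
      by (rule obtain_subset_with_card_n)
    then show ?thesis using shadow[of S] le by simp
  qed
qed

section \<open>O-sequences as functions, with a nonincreasing tail\<close>

text \<open>Padding with zeros lets monotonicity be stated past the end of the list.\<close>

definition entry :: "nat list \<Rightarrow> nat \<Rightarrow> nat" where
  "entry h i = (if i < length h then h ! i else 0)"

lemma sum_entry: "(\<Sum>i<length h. entry h i) = sum_list h"
  unfolding sum_list_sum_nth atLeast0LessThan by (rule sum.cong) (auto simp: entry_def)

text \<open>These three facts are all that the upper bound needs to know about
  multicomplexes.\<close>

lemma O_sequence_facts:
  assumes "O_sequence h"
  shows O_sequence_nonempty: "h \<noteq> []"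
    and O_sequence_last: "last h \<noteq> 0"
    and O_sequence_antimono: "entry h i \<le> i \<Longrightarrow> entry h (Suc i) \<le> entry h i"
proof -
  obtain M where M: "multicomplex M" and h: "h = f_vector M"
    using assms by (auto simp: O_sequence_def)
  have fin: "finite M" "M \<noteq> {}" using M by (auto simp: multicomplex_def)
  show "h \<noteq> []" by (simp add: h f_vector_def)
  have "Max (size ` M) \<in> size ` M" using fin by (intro Max_in) auto
  then have "{m \<in> M. size m = Max (size ` M)} \<noteq> {}" by force
  then show "last h \<noteq> 0" using fin by (simp add: h f_vector_def)
  have E: "entry h i = card {m \<in> M. size m = i}" for i
  proof (cases "i < length h")
    case True
    then show ?thesis by (simp add: entry_def h f_vector_def del: upt_Suc)
  next
    case False
    then have "i > Max (size ` M)" by (simp add: h f_vector_def)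
    moreover have "size m \<le> Max (size ` M)" if "m \<in> M" for m using fin that by simp
    ultimately have "{m \<in> M. size m = i} = {}" by force
    then show ?thesis using False by (simp only: entry_def if_False card.empty)
  qed
  show "entry h i \<le> i \<Longrightarrow> entry h (Suc i) \<le> entry h i"
    unfolding E by (rule multicomplex_card_antimono[OF M])
qed

lemma O_sequence_tail:
  assumes h: "O_sequence h" and K: "2 * sum_list h < (Suc K)\<^sup>2"
  shows "entry h K \<le> K" "K \<le> i \<Longrightarrow> i \<le> j \<Longrightarrow> entry h j \<le> entry h i"
proof -
  have "\<exists>k\<le>K. entry h k \<le> k"
  proof (rule ccontr)
    assume "\<not> ?thesis"
    then have *: "Suc k \<le> entry h k" if "k \<le> K" for k using that by force
    then have "K < length h" by (metis entry_def le_refl not_less_eq_eq zero_le)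
    have "(Suc K)\<^sup>2 \<le> 2 * (\<Sum>k\<le>K. Suc k)"
      by (induction K) (auto simp: power2_eq_square)
    also have "(\<Sum>k\<le>K. Suc k) \<le> (\<Sum>k\<le>K. entry h k)" by (rule sum_mono) (use * in auto)
    also have "\<dots> \<le> (\<Sum>k<length h. entry h k)"
      by (rule sum_mono2) (use \<open>K < length h\<close> in auto)
    finally show False using K by (simp add: sum_entry)
  qed
  then obtain k where k: "k \<le> K" "entry h k \<le> k" by blast
  \<comment> \<open>The condition propagates: it forces the next entry to be no larger, while the
    index grows.\<close>
  have below: "entry h i \<le> i" if "k \<le> i" for i
    using that by (induction rule: dec_induct) (use k O_sequence_antimono[OF h] le_trans le_SucI in blast)+
  show "entry h K \<le> K" using below k by blast
  show "entry h j \<le> entry h i" if "K \<le> i" "i \<le> j"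
    using that(2)
  proof (induction rule: dec_induct)
    case (step n)
    then show ?case
      using O_sequence_antimono[OF h, of n] below[of n] k(1) that(1) by linarith
  qed simp
qed

text \<open>Zero padding does not hide the length, because the last entry is nonzero.\<close>

lemma entry_eqD:
  assumes "O_sequence h" "O_sequence h'" and eq: "entry h = entry h'"
  shows "h = h'"
proof -
  have *: "length ys \<le> length xs" if "O_sequence ys" "entry xs = entry ys" for xs ys
  proof (rule ccontr)
    assume "\<not> ?thesis"
    then have "entry xs (length ys - 1) = 0" "entry ys (length ys - 1) = last ys"
      by (auto simp: entry_def last_conv_nth O_sequence_nonempty[OF that(1)])
    then show False using O_sequence_last[OF that(1)] that(2) by simp
  qed
  have "length h = length h'" using *[of h h'] *[of h' h] assms by simp
  then show ?thesis using eq by (intro nth_equalityI) (auto simp: entry_def fun_eq_iff, metis)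
qed

section \<open>Encoding by \<open>2 * K\<close> numbers and the upper count\<close>

text \<open>The second half lists parts of the conjugate of the tail; \<open>v < K\<close> suffices
  once the tail entries are at most \<open>K\<close>.\<close>

definition code :: "nat \<Rightarrow> nat list \<Rightarrow> nat list" where
  "code K h = map (entry h) [0..<K] @ map (\<lambda>v. card {j. K \<le> j \<and> v < entry h j}) [0..<K]"

text \<open>Since the tail is nonincreasing, the positions with entry above \<open>v\<close> form an
  interval starting at \<open>K\<close>, so their number determines them.\<close>

lemma initial_segment:
  assumes h: "O_sequence h" and K: "2 * sum_list h < (Suc K)\<^sup>2" and j: "K \<le> j"
  shows "v < entry h j \<longleftrightarrow> j < K + card {j. K \<le> j \<and> v < entry h j}"
proof -
  let ?J = "{j. K \<le> j \<and> v < entry h j}"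
  have fin: "finite ?J"
    by (rule finite_subset[of _ "{..<length h}"]) (auto simp: entry_def split: if_splits)
  show ?thesis
  proof
    assume "v < entry h j"
    then have "{K..j} \<subseteq> ?J"
      using O_sequence_tail(2)[OF h K] by (auto intro: less_le_trans)
    from card_mono[OF fin this] show "j < K + card ?J" using j by simp
  next
    assume *: "j < K + card ?J"
    show "v < entry h j"
    proof (rule ccontr)
      assume "\<not> v < entry h j"
      have "?J \<subseteq> {K..<j}"
      proof
        fix i assume i: "i \<in> ?J"
        have "\<not> j \<le> i"
        proof
          assume "j \<le> i"
          from O_sequence_tail(2)[OF h K j this] i \<open>\<not> v < entry h j\<close> show False by simp
        qed
        then show "i \<in> {K..<j}" using i by simp
      qed
      from card_mono[OF _ this] show False using * j by simp
    qed
  qed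
qed

lemma code_inj:
  assumes h: "O_sequence h" and h': "O_sequence h'"
    and K: "2 * sum_list h < (Suc K)\<^sup>2" "2 * sum_list h' < (Suc K)\<^sup>2"
    and eq: "code K h = code K h'"
  shows "h = h'"
proof (rule entry_eqD[OF h h'], rule ext)
  fix j
  have low: "entry h i = entry h' i" if "i < K" for i
    using eq that by (simp add: code_def)
  have "v < entry h j \<longleftrightarrow> v < entry h' j" if "K \<le> j" "v < K" for v
    using eq that initial_segment[OF h K(1) that(1)] initial_segment[OF h' K(2) that(1)]
    by (simp add: code_def)
  moreover have "entry h j \<le> K" "entry h' j \<le> K" if "K \<le> j"
    using that O_sequence_tail[OF h K(1)] O_sequence_tail[OF h' K(2)] by (meson le_refl le_trans)+
  \<comment> \<open>Two numbers that are at most \<open>K\<close> and exceed the same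
    \<open>v < K\<close> are equal.\<close>
  ultimately have "entry h j = entry h' j" if "K \<le> j"
    using that by (metis less_le_trans linorder_neqE_nat less_irrefl)
  then show "entry h j = entry h' j" using low by (cases "j < K") auto
qed

lemma code_range: "set (code K h) \<subseteq> {..sum_list h}"
proof -
  have "entry h i \<le> sum_list h" for i
    by (simp add: entry_def elem_le_sum_list)
  moreover have "card {j. K \<le> j \<and> v < entry h j} \<le> sum_list h" for v
  proof -
    have "card {j. K \<le> j \<and> v < entry h j} = (\<Sum>j\<in>{j. K \<le> j \<and> v < entry h j}. 1)" by simp
    \<comment> \<open>Each counted entry exceeds \<open>v\<close>, hence is at least 1.\<close>
    also have "\<dots> \<le> (\<Sum>j\<in>{j. K \<le> j \<and> v < entry h j}. entry h j)" by (rule sum_mono) auto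
    also have "\<dots> \<le> (\<Sum>j<length h. entry h j)"
      by (rule sum_mono2) (auto simp: entry_def split: if_splits)
    finally show ?thesis by (simp add: sum_entry)
  qed
  ultimately show ?thesis by (auto simp: code_def)
qed

lemma O_sequences_bound:
  assumes "2 * n < (Suc K)\<^sup>2"
  shows finite_O_sequences: "finite {h. O_sequence h \<and> sum_list h = n}"
    and L_le: "L n \<le> Suc n ^ (2 * K)"
proof -
  let ?A = "{h. O_sequence h \<and> sum_list h = n}"
  let ?B = "{xs. set xs \<subseteq> {..n} \<and> length xs = 2 * K}"
  have inj: "inj_on (code K) ?A" 
  proof (rule inj_onI)
    fix h h' assume *: "h \<in> ?A" "h' \<in> ?A" "code K h = code K h'"
    show "h = h'" by (rule code_inj[of h h' K]) (use * assms in simp_all)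
  qed
  have sub: "code K ` ?A \<subseteq> ?B"
    using code_range by (fastforce simp: code_def)
  have fin: "finite ?B" by (rule finite_lists_length_eq) simp
  show "finite ?A" by (rule inj_on_finite[OF inj sub fin])
  show "L n \<le> Suc n ^ (2 * K)"
    using card_inj_on_le[OF inj sub fin] by (simp add: L_def card_lists_length_eq)
qed

section \<open>Two-variable multicomplexes and the lower count\<close>

text \<open>In degree \<open>k\<close> keep the monomials whose second exponent is below
  \<open>g k\<close>; there are \<open>Suc k\<close> candidates, hence the \<open>min\<close>. A
  divisor has smaller or equal second exponent and degree, so antitone \<open>g\<close> gives
  closure.\<close>

lemma O_sequence_two_variables:
  fixes g :: "nat \<Rightarrow> nat"
  assumes anti: "\<And>i j. i \<le> j \<Longrightarrow> g j \<le> g i" and pos: "g e > 0" and zero: "g (Suc e) = 0"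
  shows "O_sequence (map (\<lambda>k. min (Suc k) (g k)) [0..<Suc e])"
proof -
  define mon :: "nat \<Rightarrow> nat \<Rightarrow> nat multiset"
    where "mon i j = replicate_mset i 0 + replicate_mset j 1" for i j
  define M where "M = {m. \<exists>i j. m = mon i j \<and> j < g (i + j)}"
  have cnt: "count (mon i j) 0 = i" "count (mon i j) 1 = j" "size (mon i j) = i + j" for i j
    by (auto simp: mon_def)
  have level: "{m \<in> M. size m = k} = (\<lambda>j. mon (k - j) j) ` {..<min (Suc k) (g k)}" for k
  proof (intro equalityI subsetI)
    fix m assume "m \<in> {m \<in> M. size m = k}"
    then obtain i j where "m = mon i j" "j < g (i + j)" "k = i + j" by (auto simp: M_def cnt)
    then show "m \<in> (\<lambda>j. mon (k - j) j) ` {..<min (Suc k) (g k)}"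
      by (intro image_eqI[of _ _ j]) auto
  next
    fix m assume "m \<in> (\<lambda>j. mon (k - j) j) ` {..<min (Suc k) (g k)}"
    then obtain j where j: "m = mon (k - j) j" "j \<le> k" "j < g k" by auto
    then have "j < g ((k - j) + j)" by simp
    with j show "m \<in> {m \<in> M. size m = k}" unfolding M_def
      by (intro CollectI conjI exI[of _ "k - j"] exI[of _ j]) (simp_all add: cnt)
  qed
  have "card {m \<in> M. size m = k} = min (Suc k) (g k)" for k
  proof -
    have "inj_on (\<lambda>j. mon (k - j) j) A" for A by (rule inj_onI) (metis cnt(2))
    then show ?thesis unfolding level by (simp add: card_image)
  qed
  note card = this
  have le_e: "size m \<le> e" if "m \<in> M" for m
  proof (rule ccontr)
    assume "\<not> ?thesis"
    then have "g (size m) = 0" using anti[of "Suc e" "size m"] zero by simp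
    then show False using that by (auto simp: M_def cnt)
  qed
  have "M \<subseteq> (\<Union>k\<le>e. {m \<in> M. size m = k})" using le_e by auto
  moreover have "finite (\<Union>k\<le>e. {m \<in> M. size m = k})" unfolding level by simp
  ultimately have fin: "finite M" by (rule finite_subset)
  \<comment> \<open>This pure power shows that degree \<open>e\<close> occurs.\<close>
  have "mon e 0 \<in> M"
    unfolding M_def by (intro CollectI exI[of _ e] exI[of _ 0]) (simp add: pos)
  have closed: "m' \<in> M" if in_M: "m \<in> M" and sub: "m' \<subseteq># m" for m m'
  proof -
    obtain i j where m: "m = mon i j" "j < g (i + j)" using in_M by (auto simp: M_def)
    define i' j' where "i' = count m' 0" and "j' = count m' 1"
    have le: "count m' v \<le> count m v" for v using sub by (rule mset_subset_eq_count)
    have "m' = mon i' j'"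
    proof (rule multiset_eqI)
      fix v show "count m' v = count (mon i' j') v"
        using le[of v] by (auto simp: m i'_def j'_def mon_def)
    qed
    moreover have "i' \<le> i" "j' \<le> j" using le[of 0] le[of 1] by (simp_all only: m cnt i'_def j'_def)
    then have "j' < g (i' + j')" using m(2) anti[of "i' + j'" "i + j"] by simp
    ultimately show ?thesis unfolding M_def by blast
  qed
  have "Max (size ` M) = e"
  proof (rule Max_eqI)
    show "e \<in> size ` M" using \<open>mon e 0 \<in> M\<close> cnt(3)[of e 0] by force
  qed (use fin le_e in auto)
  then have "f_vector M = map (\<lambda>k. min (Suc k) (g k)) [0..<Suc e]"
    by (simp only: f_vector_def card)
  moreover have "multicomplex M"
    using fin \<open>mon e 0 \<in> M\<close> closed by (auto simp: multicomplex_def)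
  ultimately show ?thesis by (metis O_sequence_def)
qed

text \<open>Take \<open>g\<close> constant \<open>d\<close> on the first \<open>d\<close> positions,
  then \<open>ys\<close>, then zero. The \<open>min\<close> yields the staircase first and leaves
  \<open>ys\<close> unchanged, as its entries are at most \<open>d\<close>.\<close>

lemma O_sequence_staircase:
  assumes d: "d > 0" and ys: "sorted_wrt (\<ge>) ys" "set ys \<subseteq> {1..d}"
  shows "O_sequence ([1..<Suc d] @ ys)"
proof -
  define g where "g k = (if k < d then d else if k < d + length ys then ys ! (k - d) else 0)" for k
  have ysd: "0 < ys ! k" "ys ! k \<le> d" if "k < length ys" for k
    using ys(2) nth_mem[OF that] by fastforce+
  define e where "e = d + length ys - 1"
  have e: "Suc e = d + length ys" using d by (simp add: e_def)
  have anti: "g j \<le> g i" if "i \<le> j" for i j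
  proof (cases "i < d \<or> i = j \<or> d + length ys \<le> j")
    case True
    then show ?thesis using that ysd by (auto simp: g_def)
  next
    case False
    then have "ys ! (j - d) \<le> ys ! (i - d)"
      using that by (intro sorted_wrt_nth_less[OF ys(1)]) auto
    then show ?thesis using False that by (simp add: g_def)
  qed
  have "O_sequence (map (\<lambda>k. min (Suc k) (g k)) [0..<Suc e])"
  proof (rule O_sequence_two_variables[OF anti])
    show "g e > 0" using e d ysd(1)[of "e - d"] by (auto simp: g_def)
    show "g (Suc e) = 0" unfolding e by (simp add: g_def)
  qed
  moreover have "map (\<lambda>k. min (Suc k) (g k)) [0..<Suc e] = [1..<Suc d] @ ys"
  proof (rule nth_equalityI)
    fix i assume "i < length (map (\<lambda>k. min (Suc k) (g k)) [0..<Suc e])"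
    then have i: "i < d + length ys" by (simp add: e del: upt_Suc)
    show "map (\<lambda>k. min (Suc k) (g k)) [0..<Suc e] ! i = ([1..<Suc d] @ ys) ! i"
    proof (cases "i < d")
      case True
      then show ?thesis by (simp add: e g_def nth_append del: upt_Suc)
    next
      case False
      then have "i - d < length ys" using i by simp
      then have "ys ! (i - d) \<le> Suc i" using ysd(2)[of "i - d"] False by linarith
      with False i show ?thesis by (simp add: e g_def nth_append min_absorb2 del: upt_Suc)
    qed
  qed (simp add: e del: upt_Suc)
  ultimately show ?thesis by simp
qed

lemma two_sum_staircase: "2 * sum_list [1..<Suc d] = d * Suc d"
  by (induction d) auto

lemma sorted_wrt_ge_replicate: "sorted_wrt (\<ge>) (replicate k (a::nat))"
  by (induction k) auto

text \<open>The staircase and the subset \<open>S\<close> each sum to at most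
  \<open>d * Suc d / 2\<close>, so both fit into \<open>n\<close> and ones fill the rest.\<close>

lemma L_ge_power:
  assumes d: "d > 0" and n: "d * Suc d \<le> n"
  shows "2 ^ (d - 1) \<le> L n"
proof -
  define pad where "pad S = n - sum_list [1..<Suc d] - \<Sum>S" for S :: "nat set"
  define F where "F S = [1..<Suc d] @ rev (sorted_list_of_set S) @ replicate (pad S) 1" for S
  let ?A = "{h. O_sequence h \<and> sum_list h = n}"
  have F: "F S \<in> ?A" if S: "S \<subseteq> {2..d}" for S
  proof -
    have fS: "finite S" using S finite_subset by auto
    have "\<Sum>S \<le> \<Sum>{1..d}" by (rule sum_mono2) (use S in auto)
    also have "\<dots> = sum_list [1..<Suc d]"
      by (simp add: distinct_sum_list_conv_Sum atLeastLessThanSuc_atLeastAtMost del: upt_Suc)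
    finally have "\<Sum>S \<le> sum_list [1..<Suc d]" .
    then have "sum_list [1..<Suc d] + \<Sum>S \<le> n" using two_sum_staircase[of d] n by linarith
    moreover have "sum_list (sorted_list_of_set S) = \<Sum>S"
      by (metis distinct_sum_list_conv_Sum distinct_sorted_list_of_set fS set_sorted_list_of_set)
    ultimately have "sum_list (F S) = n"
      by (simp add: F_def pad_def sum_list_replicate sum_list_rev del: upt_Suc)
    moreover have "O_sequence (F S)"
      unfolding F_def
    proof (rule O_sequence_staircase[OF d])
      show "sorted_wrt (\<ge>) (rev (sorted_list_of_set S) @ replicate (pad S) 1)"
        using S fS by (auto simp: sorted_wrt_append sorted_wrt_rev sorted_wrt_ge_replicate)
      show "set (rev (sorted_list_of_set S) @ replicate (pad S) 1) \<subseteq> {1..d}"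
        using S fS d by auto
    qed
    ultimately show ?thesis by simp
  qed
  have inj: "inj_on F (Pow {2..d})"
  proof (rule inj_onI)
    fix S T assume ST: "S \<in> Pow {2..d}" "T \<in> Pow {2..d}" "F S = F T"
    \<comment> \<open>Subsets avoid 1 so that deleting the padding does not touch
      \<open>S\<close>.\<close>
    have recover: "set (drop d (F S)) - {1} = S" if "S \<in> Pow {2..d}" for S
      using that finite_subset[of S "{2..d}"] by (auto simp: F_def simp del: upt_Suc)
    show "S = T" using recover ST by metis
  qed
  \<comment> \<open>The crude choice \<open>K = 2 * n\<close> serves only to obtain
    finiteness.\<close>
  have "2 * n < (Suc (2 * n))\<^sup>2" by (simp add: power2_eq_square)
  from card_inj_on_le[OF inj _ finite_O_sequences[OF this]] F
  show ?thesis by (auto simp: L_def card_Pow)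
qed

text \<open>This handles small \<open>n\<close> in the lower bound, with the witnesses 1, 1, ..., 1
  and 1, 2, 1, ..., 1.\<close>

lemma L_ge_2:
  assumes "n > 2"
  shows "2 \<le> L n"
proof -
  let ?h = "[1..<Suc 1] @ replicate (n - 1) 1" and ?h' = "[1..<Suc 2] @ replicate (n - 3) 1"
  have "O_sequence ?h" "O_sequence ?h'"
    by (rule O_sequence_staircase, simp, rule sorted_wrt_ge_replicate, fastforce)+
  moreover have "sum_list ?h = n" "sum_list ?h' = n"
    using assms by (simp_all add: sum_list_replicate numeral_eq_Suc)
  ultimately have sub: "{?h, ?h'} \<subseteq> {h. O_sequence h \<and> sum_list h = n}" by blast
  have "?h \<noteq> ?h'"
  proof
    assume "?h = ?h'"
    then have "?h ! 1 = ?h' ! 1" by simp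
    then show False using assms by (simp add: numeral_eq_Suc)
  qed
  then have "card {?h, ?h'} = 2" by (rule card_2_iff[THEN iffD2, OF exI, OF exI, OF conjI[OF refl]])
  moreover have "2 * n < (Suc (2 * n))\<^sup>2" by (simp add: power2_eq_square)
  ultimately show ?thesis using card_mono[OF finite_O_sequences sub] by (simp only: L_def)
qed

section \<open>Exponential form of both bounds\<close>

text \<open>The factor 1/4 makes the left side at most 2 for \<open>n \<le> 16\<close>; larger
  \<open>n\<close> use \<open>L_ge_power\<close> with \<open>d = q - 1\<close>.\<close>

lemma L_lower:
  assumes "n > 2"
  shows "exp (ln 2 / 4 * sqrt (real n)) \<le> real (L n)"
proof (cases "n \<le> 16")
  case True
  then have "sqrt (real n) \<le> 4" by (intro real_le_lsqrt) auto
  then have "ln 2 / 4 * sqrt (real n) \<le> ln 2 / 4 * 4" by (intro mult_left_mono) auto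
  then have "exp (ln 2 / 4 * sqrt (real n)) \<le> exp (ln 2)" by (subst exp_le_cancel_iff) simp
  also have "\<dots> \<le> real (L n)" using L_ge_2[OF assms] by simp
  finally show ?thesis .
next
  case False
  define q where "q = nat \<lfloor>sqrt (real n)\<rfloor>"
  have q: "real q \<le> sqrt (real n)" "sqrt (real n) < real q + 1"
    unfolding q_def by (simp_all add: of_nat_nat)
  have s: "4 \<le> sqrt (real n)" using False by (intro real_le_rsqrt) auto
  then have q4: "4 \<le> q" unfolding q_def by (simp add: le_nat_iff le_floor_iff)
  have "real (q * q) \<le> sqrt (real n) * sqrt (real n)"
    unfolding of_nat_mult using q(1) by (intro mult_mono) auto
  then have "q * q \<le> n" by (simp del: of_nat_mult)
  then have "(q - 1) * Suc (q - 1) \<le> n" using q4 by (simp add: diff_mult_distrib)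
  then have L: "2 ^ (q - 1 - 1) \<le> L n" using q4 by (intro L_ge_power) auto
  have "ln 2 / 4 * sqrt (real n) = ln 2 * (sqrt (real n) / 4)" by simp
  \<comment> \<open>With \<open>s = sqrt n\<close>, \<open>q - 2 > s - 3 \<ge> s / 4\<close>, the
    last inequality because \<open>s \<ge> 4\<close>.\<close>
  also have "\<dots> \<le> ln 2 * real (q - 1 - 1)" using q s q4 by (intro mult_left_mono) auto
  finally have "exp (ln 2 / 4 * sqrt (real n)) \<le> exp (real (q - 1 - 1) * ln 2)"
    by (simp add: mult.commute)
  also have "\<dots> = real (2 ^ (q - 1 - 1))" by (simp add: exp_of_nat_mult)
  also have "\<dots> \<le> real (L n)" using L by (rule of_nat_mono)
  finally show ?thesis .
qed

text \<open>The constant 8 is a product of three factors 2: the code has length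
  \<open>2 * K\<close>, \<open>K \<le> 2 * sqrt n\<close>, and
  \<open>ln (n + 1) \<le> 2 * ln n\<close>.\<close>

lemma L_upper:
  assumes "n > 2"
  shows "real (L n) \<le> exp (8 * sqrt (real n) * ln (real n))"
proof -
  \<comment> \<open>This is the least \<open>K\<close> with
    \<open>2 * n < (Suc K)\<^sup>2\<close>.\<close>
  define K where "K = nat \<lfloor>sqrt (2 * real n)\<rfloor>"
  have K: "real K \<le> sqrt (2 * real n)" "sqrt (2 * real n) < real K + 1"
    unfolding K_def by (simp_all add: of_nat_nat)
  have "2 * real n = (sqrt (2 * real n))\<^sup>2" by simp
  also have "\<dots> < (real K + 1)\<^sup>2" using K(2) by (intro power_strict_mono) auto
  finally have "real (2 * n) < real ((Suc K)\<^sup>2)" by (simp add: add.commute)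
  then have "2 * n < (Suc K)\<^sup>2" by (simp only: of_nat_less_iff)
  then have "L n \<le> Suc n ^ (2 * K)" by (rule L_le)
  then have "real (L n) \<le> real (Suc n ^ (2 * K))" by (rule of_nat_mono)
  also have "\<dots> = exp (real (2 * K) * ln (real (Suc n)))"
    unfolding exp_of_nat_mult by simp
  also have "\<dots> \<le> exp (2 * (2 * sqrt (real n)) * (2 * ln (real n)))"
  proof -
    have "sqrt (2 * real n) \<le> sqrt (4 * real n)" by simp
    then have "real K \<le> 2 * sqrt (real n)" using K(1) by (simp add: real_sqrt_mult)
    moreover have "ln (real (Suc n)) \<le> 2 * ln (real n)"
    proof -
      have "3 * n \<le> n * n" using assms by simp
      then have "Suc n \<le> n ^ 2" unfolding power2_eq_square using assms by linarith
      then have "real (Suc n) \<le> real n ^ 2" by (metis of_nat_le_iff of_nat_power)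
      then have "ln (real (Suc n)) \<le> ln (real n ^ 2)" by (intro ln_mono) auto
      then show ?thesis using assms by (simp add: ln_realpow)
    qed
    ultimately have "real (2 * K) * ln (real (Suc n)) \<le> (2 * (2 * sqrt (real n))) * (2 * ln (real n))"
      by (intro mult_mono) auto
    then show ?thesis by simp
  qed
  finally show ?thesis by (simp add: mult.assoc)
qed

theorem theorem1:
  "\<exists>c1 c2 :: real. c1 > 0 \<and> c2 > 0 \<and>
     (\<forall>n::nat. n > 2 \<longrightarrow>
        exp (c1 * sqrt (real n)) \<le> real (L n) \<and>
        real (L n) \<le> exp (c2 * sqrt (real n) * ln (real n)))"
  using L_lower L_upper by (intro exI[of _ "ln 2 / 4"] exI[of _ 8]) auto

end
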